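(* For all formulas $\phi,\psi$, the formula $(\phi\to\psi)\to\neg\phi\vee\psi$ (Implication-to-Disjunction) is a theorem of the propositional proof system IRL defined in the context.
   Context: Language: formulas are built from a countable set $K$ of primitive propositions using the connectives $\top,\bot$ (nullary), $\neg$ (unary), $\wedge,\vee,\leftrightarrow,\to$ (binary, all syntactically independent symbols). $\neg$ binds strongest, and $\wedge,\vee$ bind more strongly than $\to,\leftrightarrow$. Schematic letters $\phi,\psi,\chi$ range over all formulas. Axiom schemas of IRL: $\phi\leftrightarrow\phi$; $\phi\wedge\psi\leftrightarrow\psi\wedge\phi$; $\phi\vee\psi\leftrightarrow\psi\vee\phi$; $(\phi\wedge\psi)\wedge\chi\leftrightarrow\phi\wedge(\psi\wedge\chi)$; $(\phi\vee\psi)\vee\chi\leftrightarrow\phi\vee(\psi\vee\chi)$; $\phi\wedge(\psi\vee\chi)\leftrightarrow(\phi\wedge\psi)\vee(\phi\wedge\chi)$; $\phi\vee(\psi\wedge\chi)\leftrightarrow(\phi\vee\psi)\wedge(\phi\vee\chi)$; $\phi\wedge\top\leftrightarrow\phi$; $\phi\vee\bot\leftrightarrow\phi$; $\phi\wedge\neg\phi\leftrightarrow\bot$; $\phi\vee\neg\phi\leftrightarrow\top$; $(\phi\to\psi)\leftrightarrow(\phi\wedge\psi\leftrightarrow\phi)$. Primitive rules of IRL: (R1) from $\phi,\psi$ infer $\phi\wedge\psi$; (R2) from $\phi\wedge\psi$ infer $\phi$; (R3) from $\phi\leftrightarrow\psi$ and $\chi$ infer $\chi[\phi\mapsto\psi]$,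 where $\chi[\phi\mapsto\psi]$ is any formula obtained from $\chi$ by replacing one or more arbitrarily selected occurrences of the subformula $\phi$ by $\psi$; (R4, conditional proof) if $\{\phi\}\vdash\psi$ then $\vdash\phi\to\psi$. Derivations: for a finite set $X$ of formulas, $X\vdash y$ means there is a finite sequence of formulas ending in $y$, each member of which is a theorem or results from members of $X$ and earlier members of the sequence by R1, R2 or R3. A theorem is a formula $y$ with $\emptyset\vdash y$ (written $\vdash y$); axioms are theorems, and formulas $\phi\to\psi$ obtained by R4 are theorems. R4 applies only to derivations with the single premise $\phi$ and no other undischarged premises. *)

theory Defs
  imports Main "HOL-Library.Countable"
begin

datatype 'k form =
    Atom 'k
  | Top ("\<^bold>\<top>")
  | Bot ("\<^bold>\<bottom>")
  | Neg "'k form" ("\<^bold>\<not> _" [90] 90)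
  | And "'k form" "'k form" (infixr "\<^bold>\<and>" 75)
  | Or "'k form" "'k form" (infixr "\<^bold>\<or>" 75)
  | Imp "'k form" "'k form" (infixr "\<^bold>\<rightarrow>" 65)
  | Iff "'k form" "'k form" (infixr "\<^bold>\<leftrightarrow>" 65)

inductive is_axiom :: "'k form \<Rightarrow> bool" where
  "is_axiom (\<phi> \<^bold>\<leftrightarrow> \<phi>)"
| "is_axiom ((\<phi> \<^bold>\<and> \<psi>) \<^bold>\<leftrightarrow> (\<psi> \<^bold>\<and> \<phi>))"
| "is_axiom ((\<phi> \<^bold>\<or> \<psi>) \<^bold>\<leftrightarrow> (\<psi> \<^bold>\<or> \<phi>))"
| "is_axiom (((\<phi> \<^bold>\<and> \<psi>) \<^bold>\<and> \<chi>) \<^bold>\<leftrightarrow> (\<phi> \<^bold>\<and> (\<psi> \<^bold>\<and> \<chi>)))"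
| "is_axiom (((\<phi> \<^bold>\<or> \<psi>) \<^bold>\<or> \<chi>) \<^bold>\<leftrightarrow> (\<phi> \<^bold>\<or> (\<psi> \<^bold>\<or> \<chi>)))"
| "is_axiom ((\<phi> \<^bold>\<and> (\<psi> \<^bold>\<or> \<chi>)) \<^bold>\<leftrightarrow> ((\<phi> \<^bold>\<and> \<psi>) \<^bold>\<or> (\<phi> \<^bold>\<and> \<chi>)))"
| "is_axiom ((\<phi> \<^bold>\<or> (\<psi> \<^bold>\<and> \<chi>)) \<^bold>\<leftrightarrow> ((\<phi> \<^bold>\<or> \<psi>) \<^bold>\<and> (\<phi> \<^bold>\<or> \<chi>)))"
| "is_axiom ((\<phi> \<^bold>\<and> \<^bold>\<top>) \<^bold>\<leftrightarrow> \<phi>)"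
| "is_axiom ((\<phi> \<^bold>\<or> \<^bold>\<bottom>) \<^bold>\<leftrightarrow> \<phi>)"
| "is_axiom ((\<phi> \<^bold>\<and> \<^bold>\<not> \<phi>) \<^bold>\<leftrightarrow> \<^bold>\<bottom>)"
| "is_axiom ((\<phi> \<^bold>\<or> \<^bold>\<not> \<phi>) \<^bold>\<leftrightarrow> \<^bold>\<top>)"
| "is_axiom ((\<phi> \<^bold>\<rightarrow> \<psi>) \<^bold>\<leftrightarrow> ((\<phi> \<^bold>\<and> \<psi>) \<^bold>\<leftrightarrow> \<phi>))"

(* replace \<phi> \<psi> \<chi> \<chi>': \<chi>' results from \<chi> by replacing at least one, not necessarily every,
   occurrence of the subformula \<phi> by \<psi>. Distinct occurrences of \<phi> never overlap. *)
inductive replace :: "'k form \<Rightarrow> 'k form \<Rightarrow> 'k form \<Rightarrow> 'k form \<Rightarrow> bool" for \<phi> \<psi> where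
  here: "replace \<phi> \<psi> \<phi> \<psi>"
| Neg: "replace \<phi> \<psi> \<alpha> \<alpha>' \<Longrightarrow> replace \<phi> \<psi> (\<^bold>\<not> \<alpha>) (\<^bold>\<not> \<alpha>')"
| left: "\<lbrakk>c \<in> {And, Or, Imp, Iff}; replace \<phi> \<psi> \<alpha> \<alpha>'\<rbrakk> \<Longrightarrow> replace \<phi> \<psi> (c \<alpha> \<beta>) (c \<alpha>' \<beta>)"
| right: "\<lbrakk>c \<in> {And, Or, Imp, Iff}; replace \<phi> \<psi> \<beta> \<beta>'\<rbrakk> \<Longrightarrow> replace \<phi> \<psi> (c \<alpha> \<beta>) (c \<alpha> \<beta>')"
| both: "\<lbrakk>c \<in> {And, Or, Imp, Iff}; replace \<phi> \<psi> \<alpha> \<alpha>'; replace \<phi> \<psi> \<beta> \<beta>'\<rbrakk>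
          \<Longrightarrow> replace \<phi> \<psi> (c \<alpha> \<beta>) (c \<alpha>' \<beta>')"

inductive infer :: "'k form set \<Rightarrow> 'k form \<Rightarrow> bool" for S where
  R1: "\<lbrakk>\<phi> \<in> S; \<psi> \<in> S\<rbrakk> \<Longrightarrow> infer S (\<phi> \<^bold>\<and> \<psi>)"
| R2: "\<phi> \<^bold>\<and> \<psi> \<in> S \<Longrightarrow> infer S \<phi>"
| R3: "\<lbrakk>\<phi> \<^bold>\<leftrightarrow> \<psi> \<in> S; \<chi> \<in> S; replace \<phi> \<psi> \<chi> \<chi>'\<rbrakk> \<Longrightarrow> infer S \<chi>'"

(* Derivability and theoremhood refer to each other: a derivation may quote any theorem, and
   conditional proof turns a derivation into a theorem. Hence derivations are first defined
   relative to a predicate T of quotable formulas; the theorems are the least fixed point. *)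
definition derivation :: "('k form \<Rightarrow> bool) \<Rightarrow> 'k form set \<Rightarrow> 'k form list \<Rightarrow> bool" where
  "derivation T X ys \<longleftrightarrow>
     (\<forall>i < length ys. T (ys ! i) \<or> infer (X \<union> set (take i ys)) (ys ! i))"

lemma derivation_mono [mono]: "T \<le> T' \<Longrightarrow> derivation T X ys \<longrightarrow> derivation T' X ys"
  unfolding derivation_def by blast

inductive irl_theorem :: "'k form \<Rightarrow> bool" where
  "axiom": "is_axiom \<phi> \<Longrightarrow> irl_theorem \<phi>"
| derived: "derivation irl_theorem {} (ys @ [\<phi>]) \<Longrightarrow> irl_theorem \<phi>"
| R4: "derivation irl_theorem {\<phi>} (ys @ [\<psi>]) \<Longrightarrow> irl_theorem (\<phi> \<^bold>\<rightarrow> \<psi>)"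

definition derives :: "'k form set \<Rightarrow> 'k form \<Rightarrow> bool" (infix "\<turnstile>" 50) where
  "X \<turnstile> \<phi> \<longleftrightarrow> finite X \<and> (\<exists>ys. derivation irl_theorem X (ys @ [\<phi>]))"

lemma irl_theorem_iff_derives: "irl_theorem \<phi> \<longleftrightarrow> {} \<turnstile> \<phi>"
proof
  assume "irl_theorem \<phi>"
  then have "derivation irl_theorem {} ([] @ [\<phi>])"
    by (simp add: derivation_def)
  then show "{} \<turnstile> \<phi>"
    unfolding derives_def by blast
next
  assume "{} \<turnstile> \<phi>"
  then show "irl_theorem \<phi>"
    unfolding derives_def by (blast intro: irl_theorem.derived)
qed

end

(* Under the premise the definition of the conditional makes \<phi> and \<phi> \<and> \<psi> interchangeable, so
   the left disjunct of the excluded middle \<phi> \<or> \<not> \<phi> can be replaced by \<phi> \<and> \<psi>. Distributing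
   \<not> \<phi> over the conjunction gives (\<not> \<phi> \<or> \<phi>) \<and> (\<not> \<phi> \<or> \<psi>), whose second conjunct is the goal.
   Everything is an equational rewriting; the replacement rule also yields the symmetry of the
   biconditional (rewrite one side of \<phi> \<leftrightarrow> \<phi>). *)

theory Submission
  imports Defs
begin

lemma infer_mono:
  assumes "infer S \<phi>" and "S \<subseteq> S'"
  shows "infer S' \<phi>"
  using assms by cases (blast intro: infer.intros)+

text \<open>Putting \<open>xs\<close> in front only enlarges the set of formulas available to each
  step of \<open>ys\<close>, and \<open>infer\<close> is monotone in that set.\<close>

lemma derivation_append:
  assumes "derivation T X xs" and "derivation T X ys"
  shows "derivation T X (xs @ ys)"
  unfolding derivation_def
proof (intro allI impI)
  fix i assume i: "i < length (xs @ ys)"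
  show "T ((xs @ ys) ! i) \<or> infer (X \<union> set (take i (xs @ ys))) ((xs @ ys) ! i)"
  proof (cases "i < length xs")
    case True
    then show ?thesis using assms(1) by (simp add: derivation_def nth_append)
  next
    case False
    then have "T (ys ! (i - length xs)) \<or>
        infer (X \<union> set (take (i - length xs) ys)) (ys ! (i - length xs))"
      using assms(2) i by (simp add: derivation_def)
    moreover have "X \<union> set (take (i - length xs) ys) \<subseteq> X \<union> set (take i (xs @ ys))"
      using False by auto
    ultimately show ?thesis using False by (auto simp: nth_append intro: infer_mono)
  qed
qed

lemma derivation_snoc:
  assumes "derivation T X xs" and "infer (X \<union> set xs) \<phi>"
  shows "derivation T X (xs @ [\<phi>])"
  using assms by (auto simp: derivation_def nth_append less_Suc_eq)

text \<open>Lifts the primitive rules from single steps of a derivation to closure properties of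
  \<open>\<turnstile>\<close>: the derivations of both premises are concatenated and one step is
  added. A rule with one premise is covered by \<alpha> = \<beta>.\<close>

lemma derives_infer:
  assumes "X \<turnstile> \<alpha>" and "X \<turnstile> \<beta>" and "infer (X \<union> {\<alpha>, \<beta>}) \<gamma>"
  shows "X \<turnstile> \<gamma>"
proof -
  obtain xs ys where xs: "derivation irl_theorem X (xs @ [\<alpha>])"
    and ys: "derivation irl_theorem X (ys @ [\<beta>])"
    using assms(1,2) unfolding derives_def by blast
  have "derivation irl_theorem X ((xs @ [\<alpha>]) @ (ys @ [\<beta>]))"
    using xs ys by (rule derivation_append)
  moreover have "infer (X \<union> set ((xs @ [\<alpha>]) @ (ys @ [\<beta>]))) \<gamma>"
    using assms(3) by (rule infer_mono) auto
  ultimately have "derivation irl_theorem X (((xs @ [\<alpha>]) @ (ys @ [\<beta>])) @ [\<gamma>])"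
    by (rule derivation_snoc)
  then show ?thesis using assms(1) unfolding derives_def by blast
qed

lemma derives_conjI: "X \<turnstile> \<alpha> \<Longrightarrow> X \<turnstile> \<beta> \<Longrightarrow> X \<turnstile> \<alpha> \<^bold>\<and> \<beta>"
  by (erule (1) derives_infer) (simp add: infer.R1)

lemma derives_conjD1: "X \<turnstile> \<alpha> \<^bold>\<and> \<beta> \<Longrightarrow> X \<turnstile> \<alpha>"
  by (rule derives_infer[of X "\<alpha> \<^bold>\<and> \<beta>" "\<alpha> \<^bold>\<and> \<beta>"]) (auto intro: infer.R2)

lemma derives_replace:
  "X \<turnstile> \<alpha> \<^bold>\<leftrightarrow> \<beta> \<Longrightarrow> X \<turnstile> \<chi> \<Longrightarrow> replace \<alpha> \<beta> \<chi> \<chi>' \<Longrightarrow> X \<turnstile> \<chi>'"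
  by (erule (1) derives_infer) (blast intro: infer.R3)

lemma derives_axiom:
  assumes "finite X" and "is_axiom \<phi>"
  shows "X \<turnstile> \<phi>"
proof -
  have "derivation irl_theorem X ([] @ [\<phi>])"
    using assms(2) by (simp add: derivation_def irl_theorem.axiom)
  then show ?thesis using assms(1) unfolding derives_def by blast
qed

(* A derivation need not list its premises, so a premise is reached through R1 and R2. *)
lemma derives_premise:
  assumes "finite X" and "\<phi> \<in> X"
  shows "X \<turnstile> \<phi>"
proof -
  have "X \<turnstile> \<phi> \<^bold>\<leftrightarrow> \<phi>"
    using assms(1) by (intro derives_axiom is_axiom.intros)
  then have "X \<turnstile> \<phi> \<^bold>\<and> \<phi>"
    using assms(2) by (blast intro: derives_infer infer.R1)
  then show ?thesis by (rule derives_conjD1)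
qed

text \<open>This is R3 at the root: the replaced occurrence of \<alpha> is the whole
  formula.\<close>

lemma derives_iff_mp:
  assumes "X \<turnstile> \<alpha> \<^bold>\<leftrightarrow> \<beta>" and "X \<turnstile> \<alpha>"
  shows "X \<turnstile> \<beta>"
  using assms replace.here by (rule derives_replace)

lemma derives_iff_sym:
  assumes "X \<turnstile> \<alpha> \<^bold>\<leftrightarrow> \<beta>"
  shows "X \<turnstile> \<beta> \<^bold>\<leftrightarrow> \<alpha>"
proof (rule derives_replace[OF assms])
  show "X \<turnstile> \<alpha> \<^bold>\<leftrightarrow> \<alpha>"
    using assms by (intro derives_axiom is_axiom.intros) (simp add: derives_def)
  \<comment> \<open>R3 may select occurrences, so the right-hand \<alpha> stays in place.\<close>
  show "replace \<alpha> \<beta> (\<alpha> \<^bold>\<leftrightarrow> \<alpha>) (\<beta> \<^bold>\<leftrightarrow> \<alpha>)"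
    by (simp add: replace.left replace.here)
qed

text \<open>R2 yields only the left conjunct, so commutativity comes first.\<close>

lemma derives_conjD2:
  assumes "X \<turnstile> \<alpha> \<^bold>\<and> \<beta>"
  shows "X \<turnstile> \<beta>"
proof -
  have "X \<turnstile> (\<alpha> \<^bold>\<and> \<beta>) \<^bold>\<leftrightarrow> (\<beta> \<^bold>\<and> \<alpha>)"
    using assms by (intro derives_axiom is_axiom.intros) (simp add: derives_def)
  then show ?thesis using assms by (blast intro: derives_iff_mp derives_conjD1)
qed

lemma derives_Top:
  assumes "finite X"
  shows "X \<turnstile> \<^bold>\<top>"
proof (rule derives_conjD2)
  \<comment> \<open>Any derivable formula would serve here: the identity axiom for conjunction, read
    backwards, attaches \<open>Top\<close> to it as a right conjunct.\<close>
  let ?\<alpha> = "\<^bold>\<top> \<^bold>\<leftrightarrow> \<^bold>\<top>"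
  have "X \<turnstile> (?\<alpha> \<^bold>\<and> \<^bold>\<top>) \<^bold>\<leftrightarrow> ?\<alpha>" and "X \<turnstile> ?\<alpha>"
    using assms by (simp_all add: derives_axiom is_axiom.intros)
  then show "X \<turnstile> ?\<alpha> \<^bold>\<and> \<^bold>\<top>"
    by (blast intro: derives_iff_mp derives_iff_sym)
qed

text \<open>The axiom only equates the disjunction with \<open>Top\<close>, so it is read backwards
  from the derived \<open>Top\<close>.\<close>

lemma derives_excluded_middle:
  assumes "finite X"
  shows "X \<turnstile> \<phi> \<^bold>\<or> \<^bold>\<not> \<phi>"
proof (rule derives_iff_mp[OF derives_iff_sym derives_Top[OF assms]])
  show "X \<turnstile> (\<phi> \<^bold>\<or> \<^bold>\<not> \<phi>) \<^bold>\<leftrightarrow> \<^bold>\<top>"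
    using assms by (intro derives_axiom is_axiom.intros)
qed

lemma derives_imp_to_disj:
  assumes "X \<turnstile> \<phi> \<^bold>\<rightarrow> \<psi>"
  shows "X \<turnstile> \<^bold>\<not> \<phi> \<^bold>\<or> \<psi>"
proof -
  have fin: "finite X"
    using assms by (simp add: derives_def)
  have "X \<turnstile> (\<phi> \<^bold>\<rightarrow> \<psi>) \<^bold>\<leftrightarrow> ((\<phi> \<^bold>\<and> \<psi>) \<^bold>\<leftrightarrow> \<phi>)"
    using fin by (intro derives_axiom is_axiom.intros)
  then have "X \<turnstile> \<phi> \<^bold>\<leftrightarrow> (\<phi> \<^bold>\<and> \<psi>)"
    using assms by (blast intro: derives_iff_mp derives_iff_sym)
  \<comment> \<open>The occurrence of \<phi> under the negation is left alone.\<close>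
  moreover have "replace \<phi> (\<phi> \<^bold>\<and> \<psi>) (\<phi> \<^bold>\<or> \<^bold>\<not> \<phi>) ((\<phi> \<^bold>\<and> \<psi>) \<^bold>\<or> \<^bold>\<not> \<phi>)"
    by (simp add: replace.left replace.here)
  ultimately have "X \<turnstile> (\<phi> \<^bold>\<and> \<psi>) \<^bold>\<or> \<^bold>\<not> \<phi>"
    using derives_excluded_middle[OF fin] by (blast intro: derives_replace)
  \<comment> \<open>The distributive axiom expects the conjunction as the right disjunct, hence the
    commutation.\<close>
  moreover have "X \<turnstile> ((\<phi> \<^bold>\<and> \<psi>) \<^bold>\<or> \<^bold>\<not> \<phi>) \<^bold>\<leftrightarrow> (\<^bold>\<not> \<phi> \<^bold>\<or> (\<phi> \<^bold>\<and> \<psi>))"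
    and "X \<turnstile> (\<^bold>\<not> \<phi> \<^bold>\<or> (\<phi> \<^bold>\<and> \<psi>)) \<^bold>\<leftrightarrow> ((\<^bold>\<not> \<phi> \<^bold>\<or> \<phi>) \<^bold>\<and> (\<^bold>\<not> \<phi> \<^bold>\<or> \<psi>))"
    using fin by (simp_all add: derives_axiom is_axiom.intros)
  ultimately have "X \<turnstile> (\<^bold>\<not> \<phi> \<^bold>\<or> \<phi>) \<^bold>\<and> (\<^bold>\<not> \<phi> \<^bold>\<or> \<psi>)"
    by (blast intro: derives_iff_mp)
  then show ?thesis by (rule derives_conjD2)
qed

text \<open>Restates R4 through \<open>\<turnstile>\<close>, identifying theorems with the formulas
  derivable from no premises.\<close>

lemma conditional_proof:
  assumes "{\<phi>} \<turnstile> \<psi>"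
  shows "{} \<turnstile> \<phi> \<^bold>\<rightarrow> \<psi>"
  using assms irl_theorem.R4 unfolding irl_theorem_iff_derives[symmetric]
  by (auto simp: derives_def)

theorem theorem3p4p7:
  fixes \<phi> \<psi> :: "'k::countable form"
  shows "{} \<turnstile> (\<phi> \<^bold>\<rightarrow> \<psi>) \<^bold>\<rightarrow> (\<^bold>\<not> \<phi> \<^bold>\<or> \<psi>)"
  \<comment> \<open>The single premise discharged is the conditional
    \<open>\<phi> \<rightarrow> \<psi>\<close> itself.\<close>
  by (intro conditional_proof derives_imp_to_disj derives_premise) simp_all

end
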